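(* Let $\Lambda:\mathbb{R}\to[0,1]$ be decreasing. Then $$\mathrm{ES}_\Lambda(X)=\sup_{\mathbb Q\in\mathcal M_{1,f}}R(\mathbb E_{\mathbb Q}[X],\mathbb Q),\quad X\in L^1,$$ where for $(t,\mathbb Q)\in\mathbb{R}\times\mathcal M_{1,f}$, $$R(t,\mathbb Q)=\sup_{x\in\mathbb{R}}\left\{t\wedge x:\ \Lambda(x)\ge1-\frac{\mathrm d\mathbb P}{\mathrm d\mathbb Q},\ \mathbb Q\text{-almost surely}\right\}.$$ Moreover: (i) the supremum over $\mathbb Q$ can be replaced by a maximum if $\Lambda$ is left-continuous; (ii) $(t,\mathbb Q)\mapsto R(t,\mathbb Q)$ is upper semicontinuous, quasi-concave, and increasing in $t$; (iii) $\inf_{t\in\mathbb{R}}R(t,\mathbb Q)=\inf_{t\in\mathbb{R}}R(t,\mathbb Q')$ for all $\mathbb Q,\mathbb Q'\in\mathcal M_{1,f}$; (iv) $R(t_1,\mathbb Q)-R(t_2,\mathbb Q)\le t_1-t_2$ for all $t_1\ge t_2$ and $\mathbb Q\in\mathcal M_{1,f}$.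
   Context: $(\Omega,\mathcal F,\mathbb P)$ is an atomless probability space, $L^0$ all random variables, $L^1$ integrable ones; "decreasing" is weak; $\wedge=\min$. $\mathcal M_{1,f}$ is the set of finitely additive probability measures on $(\Omega,\mathcal F)$ absolutely continuous with respect to $\mathbb P$; $\mathrm d\mathbb P/\mathrm d\mathbb Q$ denotes $1/(\mathrm d\mathbb Q/\mathrm d\mathbb P)$ with $1/0=\infty$. For $\alpha\in[0,1]$, $X\in L^0$: $\mathrm{VaR}_\alpha(X)=\inf\{x\in\mathbb{R}:\mathbb P(X\le x)\ge\alpha\}$. For $X\in L^1$: $\mathrm{ES}_\alpha(X)=\frac{1}{1-\alpha}\int_\alpha^1\mathrm{VaR}_\beta(X)\,\mathrm d\beta$ for $\alpha<1$, $\mathrm{ES}_1(X)=\mathrm{VaR}_1(X)$; $\mathrm{ES}_\Lambda(X)=\sup_{x\in\mathbb{R}}\left(\mathrm{ES}_{\Lambda(x)}(X)\wedge x\right)$. *)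

theory Defs
  imports "HOL-Probability.Probability"
begin

definition atomless :: "'a measure \<Rightarrow> bool" where
  "atomless M \<longleftrightarrow> (\<forall>A\<in>sets M. 0 < measure M A \<longrightarrow>
      (\<exists>B\<in>sets M. B \<subseteq> A \<and> 0 < measure M B \<and> measure M B < measure M A))"

text \<open>Value-at-Risk, extended-real valued (VaR_0 = -inf, VaR_1 may be +inf).\<close>
definition VaR :: "'a measure \<Rightarrow> real \<Rightarrow> ('a \<Rightarrow> real) \<Rightarrow> ereal" where
  "VaR M \<alpha> X = Inf {ereal x | x. measure M {\<omega>\<in>space M. X \<omega> \<le> x} \<ge> \<alpha>}"

definition ES :: "'a measure \<Rightarrow> real \<Rightarrow> ('a \<Rightarrow> real) \<Rightarrow> ereal" where
  "ES M \<alpha> X = (if \<alpha> < 1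
      then ereal ((1 / (1 - \<alpha>)) * (LINT \<beta>:{\<alpha>..1}|lborel. real_of_ereal (VaR M \<beta> X)))
      else VaR M 1 X)"

definition ES_Lambda :: "'a measure \<Rightarrow> (real \<Rightarrow> real) \<Rightarrow> ('a \<Rightarrow> real) \<Rightarrow> ereal" where
  "ES_Lambda M \<Lambda> X = (SUP x::real. min (ES M (\<Lambda> x) X) (ereal x))"

definition M1f :: "'a measure \<Rightarrow> ('a set \<Rightarrow> real) set" where
  "M1f M = {Q. (\<forall>A. A \<notin> sets M \<longrightarrow> Q A = 0)
      \<and> (\<forall>A\<in>sets M. 0 \<le> Q A)
      \<and> Q (space M) = 1
      \<and> (\<forall>A\<in>sets M. \<forall>B\<in>sets M. A \<inter> B = {} \<longrightarrow> Q (A \<union> B) = Q A + Q B)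
      \<and> (\<forall>A\<in>sets M. measure M A = 0 \<longrightarrow> Q A = 0)}"

text \<open>Expectation under a finitely additive probability (layer-cake formula,
  E_Q[X^+] - E_Q[X^-], extended-real valued).\<close>
definition fa_expect :: "'a measure \<Rightarrow> ('a set \<Rightarrow> real) \<Rightarrow> ('a \<Rightarrow> real) \<Rightarrow> ereal" where
  "fa_expect M Q X =
     enn2ereal (\<integral>\<^sup>+ s. indicator {0..} s * ennreal (Q {\<omega>\<in>space M. s < X \<omega>}) \<partial>lborel)
   - enn2ereal (\<integral>\<^sup>+ s. indicator {0..} s * ennreal (Q {\<omega>\<in>space M. X \<omega> < - s}) \<partial>lborel)"

definition has_density :: "'a measure \<Rightarrow> ('a set \<Rightarrow> real) \<Rightarrow> ('a \<Rightarrow> real) \<Rightarrow> bool" where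
  "has_density M Q D \<longleftrightarrow> D \<in> borel_measurable M \<and> (\<forall>\<omega>\<in>space M. 0 \<le> D \<omega>)
      \<and> integrable M D \<and> (\<forall>A\<in>sets M. Q A = (LINT \<omega>:A|M. D \<omega>))"

definition dPdQ :: "('a \<Rightarrow> real) \<Rightarrow> 'a \<Rightarrow> ereal" where
  "dPdQ D \<omega> = (if D \<omega> = 0 then \<infinity> else ereal (1 / D \<omega>))"

text \<open>The constraint  Lambda(x) \<ge> 1 - dP/dQ, Q-a.s.  For Q without a density
  (purely finitely additive part) dQ/dP is regarded as infinite, so the constraint
  reduces to Lambda(x) = 1 (which is trivially satisfied in the paper's formula).\<close>
definition feasible :: "'a measure \<Rightarrow> (real \<Rightarrow> real) \<Rightarrow> ('a set \<Rightarrow> real) \<Rightarrow> real \<Rightarrow> bool" where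
  "feasible M \<Lambda> Q x \<longleftrightarrow> \<Lambda> x = 1 \<or>
     (\<exists>D. has_density M Q D \<and> Q {\<omega>\<in>space M. ereal (\<Lambda> x) < 1 - dPdQ D \<omega>} = 0)"

definition R :: "'a measure \<Rightarrow> (real \<Rightarrow> real) \<Rightarrow> ereal \<Rightarrow> ('a set \<Rightarrow> real) \<Rightarrow> ereal" where
  "R M \<Lambda> t Q = Sup ((\<lambda>x. min t (ereal x)) ` {x. feasible M \<Lambda> Q x})"

definition usc_on :: "'b::topological_space set \<Rightarrow> ('b \<Rightarrow> ereal) \<Rightarrow> bool" where
  "usc_on S f \<longleftrightarrow> (\<forall>p\<in>S. \<forall>c. f p < c \<longrightarrow>
      (\<exists>U. open U \<and> p \<in> U \<and> (\<forall>q\<in>U \<inter> S. f q < c)))"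

end

theory Submission
  imports Defs
begin

text \<open>
  For fixed \<open>x\<close> the constraint on \<open>Q\<close> says \<open>(1 - \<Lambda> x) Q \<le> P\<close>, which is the feasible set in the
  dual representation of \<open>ES\<close> at level \<open>\<Lambda> x\<close>. Hence the supremum over \<open>Q\<close> of
  \<open>min (E_Q X) x\<close> under this constraint is \<open>min (ES (\<Lambda> x) X) x\<close>, and exchanging the suprema over
  \<open>x\<close> and \<open>Q\<close> gives the formula. For every \<open>x\<close> the inner supremum is attained: for
  \<open>\<Lambda> x < 1\<close> by a normalized tail density, for \<open>\<Lambda> x = 1\<close> by a finitely additive measure
  concentrated near the essential supremum, which exists by Tychonoff compactness. If \<open>\<Lambda>\<close> is
  left-continuous, the supremum over \<open>x\<close> is moreover attained at the value \<open>x = ES_\<Lambda> X\<close> itself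
  when this is finite. Upper semicontinuity and quasi-concavity hold because the constraint is
  closed and convex in \<open>Q\<close>.
\<close>

subsection \<open>Expectations and densities\<close>

text \<open>Tonelli for the region 0 \<le> s < f: the section over a point has length f there, or 0
  if f is negative. On the right \<open>ennreal\<close> performs the same truncation, so this is the
  integral of the positive part.\<close>

lemma layer_cake_positive_part:
  fixes f :: "'a \<Rightarrow> real"
  assumes "sigma_finite_measure N" and f[measurable]: "f \<in> borel_measurable N"
  shows "(\<integral>\<^sup>+ s. indicator {0..} s * emeasure N {\<omega>\<in>space N. s < f \<omega>} \<partial>lborel)
    = (\<integral>\<^sup>+ \<omega>. ennreal (f \<omega>) \<partial>N)"
proof -
  interpret N: sigma_finite_measure N by fact
  interpret L: pair_sigma_finite N "lborel :: real measure" ..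
  let ?h = "\<lambda>\<omega> s. indicator {0..} s * indicator {s<..} (f \<omega>) :: ennreal"
  have h: "?h \<omega> s = indicator {0..<f \<omega>} s" for \<omega> s
    by (auto split: split_indicator)
  have "(\<integral>\<^sup>+ s. indicator {0..} s * emeasure N {\<omega>\<in>space N. s < f \<omega>} \<partial>lborel)
      = (\<integral>\<^sup>+ s. \<integral>\<^sup>+ \<omega>. ?h \<omega> s \<partial>N \<partial>lborel)"
  proof (rule nn_integral_cong)
    fix s :: real
    have "(\<integral>\<^sup>+ \<omega>. ?h \<omega> s \<partial>N)
        = (\<integral>\<^sup>+ \<omega>. indicator {0..} s * indicator {\<omega>\<in>space N. s < f \<omega>} \<omega> \<partial>N)"
      by (intro nn_integral_cong) (auto split: split_indicator)
    also have "\<dots> = indicator {0..} s * emeasure N {\<omega>\<in>space N. s < f \<omega>}"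
      by (subst nn_integral_cmult) auto
    finally show "indicator {0..} s * emeasure N {\<omega>\<in>space N. s < f \<omega>} = (\<integral>\<^sup>+ \<omega>. ?h \<omega> s \<partial>N)"
      by simp
  qed
  also have "\<dots> = (\<integral>\<^sup>+ \<omega>. \<integral>\<^sup>+ s. ?h \<omega> s \<partial>lborel \<partial>N)"
  proof (rule L.Fubini')
    have "(\<lambda>p. indicator {p\<in>space (N \<Otimes>\<^sub>M lborel). 0 \<le> snd p \<and> snd p < f (fst p)} p :: ennreal)
        \<in> borel_measurable (N \<Otimes>\<^sub>M lborel)"
      by measurable
    also have "?this \<longleftrightarrow> case_prod ?h \<in> borel_measurable (N \<Otimes>\<^sub>M lborel)"
      by (intro measurable_cong) (auto split: split_indicator)
    finally show "case_prod ?h \<in> borel_measurable (N \<Otimes>\<^sub>M lborel)" .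
  qed
  also have "\<dots> = (\<integral>\<^sup>+ \<omega>. ennreal (f \<omega>) \<partial>N)"
    unfolding h
  proof (rule nn_integral_cong)
    fix \<omega>
    show "(\<integral>\<^sup>+ s. indicator {0..<f \<omega>} s \<partial>lborel) = ennreal (f \<omega>)"
      by (cases "0 \<le> f \<omega>") (auto simp: ennreal_neg)
  qed
  finally show ?thesis .
qed

section \<open>Densities of finitely additive measures and the constraint on them\<close>

context prob_space
begin

lemma set_integral_eq_density:
  fixes D :: "'a \<Rightarrow> real"
  assumes "integrable M D" "\<forall>\<omega>\<in>space M. 0 \<le> D \<omega>" "A \<in> sets M"
  shows "ennreal (LINT \<omega>:A|M. D \<omega>) = emeasure (density M (\<lambda>\<omega>. ennreal (D \<omega>))) A"
proof -
  have [measurable]: "D \<in> borel_measurable M" using assms(1) by auto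
  have [measurable]: "A \<in> sets M" by fact
  have "emeasure (density M (\<lambda>\<omega>. ennreal (D \<omega>))) A
      = (\<integral>\<^sup>+ \<omega>. ennreal (D \<omega>) * indicator A \<omega> \<partial>M)"
    using assms by (intro emeasure_density) auto
  also have "\<dots> = (\<integral>\<^sup>+ \<omega>. ennreal (indicator A \<omega> *\<^sub>R D \<omega>) \<partial>M)"
    by (intro nn_integral_cong) (auto split: split_indicator)
  also have "\<dots> = ennreal (LINT \<omega>:A|M. D \<omega>)"
    unfolding set_lebesgue_integral_def
    using assms integrable_mult_indicator[OF assms(3,1)]
    by (intro nn_integral_eq_integral AE_I2) (auto split: split_indicator)
  finally show ?thesis by simp
qed

text \<open>The layer-cake formula is applied to X and to -X under the measure D dP. Integrability
  of D X makes both parts finite, so their extended-real difference is the ordinary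
  integral.\<close>

lemma fa_expect_density:
  assumes Q: "has_density M Q D" and [measurable]: "X \<in> borel_measurable M"
    and int: "integrable M (\<lambda>\<omega>. D \<omega> * X \<omega>)"
  shows "fa_expect M Q X = ereal (LINT \<omega>|M. D \<omega> * X \<omega>)"
proof -
  have [measurable]: "D \<in> borel_measurable M" and Dnn: "\<forall>\<omega>\<in>space M. 0 \<le> D \<omega>"
    and Dint: "integrable M D" and QA: "\<And>A. A \<in> sets M \<Longrightarrow> Q A = (LINT \<omega>:A|M. D \<omega>)"
    using Q by (auto simp: has_density_def)
  let ?N = "density M (\<lambda>\<omega>. ennreal (D \<omega>))"
  have Q_eq: "ennreal (Q A) = emeasure ?N A" if "A \<in> sets M" for A
    using set_integral_eq_density[OF Dint Dnn that] QA[OF that] by simp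
  have "finite_measure ?N"
    using Q_eq[of "space M"] by (intro finite_measureI) (auto simp flip: Q_eq)
  then have sf: "sigma_finite_measure ?N"
    by (simp add: finite_measure_def)
  have lc: "(\<integral>\<^sup>+ s. indicator {0..} s * ennreal (Q {\<omega>\<in>space M. s < Y \<omega>}) \<partial>lborel)
      = (\<integral>\<^sup>+ \<omega>. ennreal (D \<omega> * Y \<omega>) \<partial>M)" if [measurable]: "Y \<in> borel_measurable M" for Y
  proof -
    have "(\<integral>\<^sup>+ s. indicator {0..} s * ennreal (Q {\<omega>\<in>space M. s < Y \<omega>}) \<partial>lborel)
       = (\<integral>\<^sup>+ s. indicator {0..} s * emeasure ?N {\<omega>\<in>space ?N. s < Y \<omega>} \<partial>lborel)"
      by (intro nn_integral_cong) (simp add: Q_eq)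
    also have "\<dots> = (\<integral>\<^sup>+ \<omega>. ennreal (Y \<omega>) \<partial>?N)"
      by (rule layer_cake_positive_part[OF sf]) simp
    also have "\<dots> = (\<integral>\<^sup>+ \<omega>. ennreal (D \<omega>) * ennreal (Y \<omega>) \<partial>M)"
      by (rule nn_integral_density) auto
    also have "\<dots> = (\<integral>\<^sup>+ \<omega>. ennreal (D \<omega> * Y \<omega>) \<partial>M)"
      using Dnn by (intro nn_integral_cong) (auto simp: ennreal_mult')
    finally show ?thesis .
  qed
  let ?p = "\<integral>\<^sup>+ \<omega>. ennreal (D \<omega> * X \<omega>) \<partial>M" and ?n = "\<integral>\<^sup>+ \<omega>. ennreal (- (D \<omega> * X \<omega>)) \<partial>M"
  have neg: "{\<omega>\<in>space M. X \<omega> < - s} = {\<omega>\<in>space M. s < - X \<omega>}" for s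
    by auto
  have fin: "?p < \<infinity>" "?n < \<infinity>"
    using int by (auto simp: real_integrable_def less_top)
  have "fa_expect M Q X = enn2ereal ?p - enn2ereal ?n"
    unfolding fa_expect_def neg using lc[of X] lc[of "\<lambda>\<omega>. - X \<omega>"] by simp
  also have "\<dots> = ereal (enn2real ?p - enn2real ?n)"
    using fin by (cases ?p; cases ?n) auto
  also have "\<dots> = ereal (LINT \<omega>|M. D \<omega> * X \<omega>)"
    using int by (simp add: real_lebesgue_integral_def)
  finally show ?thesis .
qed

text \<open>Domination by P / c passes continuity at the empty set from P to Q. An additive set
  function with this continuity is countably additive, so Radon-Nikodym applies. Hence a Q without
  density can satisfy the constraint only where \<Lambda> equals 1.\<close>

lemma dominated_fa_has_density:
  assumes Q: "Q \<in> M1f M" and "0 < c"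
    and dom: "\<And>A. A \<in> sets M \<Longrightarrow> Q A * c \<le> prob A"
  obtains D where "has_density M Q D"
proof -
  have Q0: "0 \<le> Q A" if "A \<in> sets M" for A using Q that by (auto simp: M1f_def)
  have Qadd: "Q (A \<union> B) = Q A + Q B" if "A \<in> sets M" "B \<in> sets M" "A \<inter> B = {}" for A B
    using Q that by (auto simp: M1f_def)
  have Qempty: "Q {} = 0" using Q by (auto simp: M1f_def)
  let ?q = "\<lambda>A. ennreal (Q A)"
  have pos: "positive (sets M) ?q" by (simp add: positive_def Qempty)
  have add: "additive (sets M) ?q"
    by (auto simp: additive_def Qadd Q0)
  have ca: "countably_additive (sets M) ?q"
  proof (rule sets.empty_continuous_imp_countably_additive[OF pos add])
    fix A :: "nat \<Rightarrow> 'a set" assume A: "range A \<subseteq> sets M" "decseq A" "(\<Inter>i. A i) = {}"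
    have "(\<lambda>i. prob (A i)) \<longlonglongrightarrow> prob (\<Inter>i. A i)"
      by (rule finite_Lim_measure_decseq) (use A in auto)
    then have lim: "(\<lambda>i. prob (A i) / c) \<longlonglongrightarrow> 0"
      using A(3) tendsto_divide[OF _ tendsto_const, of _ 0 _ c] \<open>0 < c\<close> by force
    have "(\<lambda>i. Q (A i)) \<longlonglongrightarrow> 0"
    proof (rule tendsto_sandwich[OF _ _ tendsto_const lim])
      show "\<forall>\<^sub>F i in sequentially. 0 \<le> Q (A i)" using A Q0 by auto
      show "\<forall>\<^sub>F i in sequentially. Q (A i) \<le> prob (A i) / c"
        using A dom \<open>0 < c\<close> by (auto simp: field_simps range_subsetD)
    qed
    then show "(\<lambda>i. ennreal (Q (A i))) \<longlonglongrightarrow> 0"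
      using tendsto_ennrealI by fastforce
  qed simp
  define N where "N = measure_of (space M) (sets M) ?q"
  have [simp]: "sets N = sets M" "space N = space M"
    by (simp_all add: N_def sets.sigma_sets_eq)
  have emN: "emeasure N A = ennreal (Q A)" if "A \<in> sets M" for A
    unfolding N_def by (rule emeasure_measure_of_sigma[OF _ pos ca that]) unfold_locales
  have finN: "finite_measure N"
    by (intro finite_measureI) (simp add: emN)
  have ac: "absolutely_continuous M N"
    unfolding absolutely_continuous_def
  proof (intro subsetI)
    fix A assume "A \<in> null_sets M"
    then have "A \<in> sets M" "prob A = 0" by (auto simp: null_sets_def measure_def)
    then have "Q A = 0" using Q by (auto simp: M1f_def)
    then show "A \<in> null_sets N" using \<open>A \<in> sets M\<close> by (auto simp: null_sets_def emN)
  qed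
  obtain D where D[measurable]: "D \<in> borel_measurable M"
    and DR: "AE x in M. RN_deriv M N x = ennreal (D x)" and Dnn: "\<And>x. 0 \<le> D x"
    using real_RN_deriv[OF finN ac] by auto
  have N_eq: "density M (\<lambda>x. ennreal (D x)) = N"
    using density_RN_deriv[OF ac] density_cong[OF _ _ DR] by simp
  have "(\<integral>\<^sup>+ x. ennreal (D x) \<partial>M) = emeasure N (space M)"
    by (subst N_eq[symmetric], subst emeasure_density) (auto intro!: nn_integral_cong)
  then have Dint: "integrable M D"
    using Dnn by (intro integrableI_nonneg) (auto simp: emN)
  have "has_density M Q D"
    unfolding has_density_def
  proof (intro conjI ballI D Dint Dnn)
    fix A assume A: "A \<in> sets M"
    have "ennreal (LINT \<omega>:A|M. D \<omega>) = ennreal (Q A)"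
      using set_integral_eq_density[OF Dint _ A] Dnn N_eq emN[OF A] by simp
    moreover have "0 \<le> (LINT \<omega>:A|M. D \<omega>)"
      unfolding set_lebesgue_integral_def using Dnn by (intro integral_nonneg_AE) auto
    ultimately show "Q A = (LINT \<omega>:A|M. D \<omega>)" using Q0[OF A] by simp
  qed
  then show ?thesis ..
qed

text \<open>\<open>prob A - Q A * c\<close> is the integral of 1 - D c over A. For the forward
  direction, test it on the set where D c > 1: there the integrand is negative, so domination forces
  that set to be null.\<close>

lemma density_bound_iff:
  assumes Q: "has_density M Q D"
  shows "(\<forall>A\<in>sets M. Q A * c \<le> prob A) \<longleftrightarrow> (AE \<omega> in M. D \<omega> * c \<le> 1)"
proof
  have [measurable]: "D \<in> borel_measurable M" and Dint: "integrable M D"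
    and QA: "\<And>A. A \<in> sets M \<Longrightarrow> Q A = (LINT \<omega>:A|M. D \<omega>)"
    using Q by (auto simp: has_density_def)
  have diff: "prob A - Q A * c = (LINT \<omega>|M. indicator A \<omega> * (1 - D \<omega> * c))"
    if [measurable]: "A \<in> sets M" for A
  proof -
    have "integrable M (\<lambda>\<omega>. indicator A \<omega> * D \<omega>)"
      using integrable_mult_indicator[OF that Dint] by simp
    moreover have "(LINT \<omega>|M. indicator A \<omega> * (1 - D \<omega> * c))
        = (LINT \<omega>|M. indicator A \<omega> - (indicator A \<omega> * D \<omega>) * c)"
      by (intro Bochner_Integration.integral_cong) (auto simp: algebra_simps)
    ultimately show ?thesis
      using QA[OF that] by (simp add: set_lebesgue_integral_def emeasure_eq_measure)
  qed
  {
    assume dom: "\<forall>A\<in>sets M. Q A * c \<le> prob A"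
    define B where "B = {\<omega>\<in>space M. D \<omega> * c > 1}"
    have B[measurable]: "B \<in> sets M" by (simp add: B_def)
    let ?f = "\<lambda>\<omega>. indicator B \<omega> * (D \<omega> * c - 1)"
    have int: "integrable M ?f"
      using integrable_mult_indicator[OF B, of "\<lambda>\<omega>. D \<omega> * c - 1"] Dint by simp
    have nn: "AE \<omega> in M. 0 \<le> ?f \<omega>"
      by (intro AE_I2) (auto simp: B_def split: split_indicator)
    have "(LINT \<omega>|M. ?f \<omega>) = - (LINT \<omega>|M. indicator B \<omega> * (1 - D \<omega> * c))"
      by (subst Bochner_Integration.integral_minus[symmetric])
        (auto intro!: Bochner_Integration.integral_cong simp: algebra_simps)
    then have "(LINT \<omega>|M. ?f \<omega>) \<le> 0"
      using dom B diff[OF B] by fastforce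
    then have "(LINT \<omega>|M. ?f \<omega>) = 0"
      using integral_nonneg_AE[OF nn] by simp
    then have "AE \<omega> in M. ?f \<omega> = 0"
      using integral_nonneg_eq_0_iff_AE[OF int nn] by simp
    then show "AE \<omega> in M. D \<omega> * c \<le> 1"
      using AE_space by eventually_elim (auto simp: B_def split: split_indicator_asm)
  next
    assume ae: "AE \<omega> in M. D \<omega> * c \<le> 1"
    show "\<forall>A\<in>sets M. Q A * c \<le> prob A"
    proof
      fix A assume "A \<in> sets M"
      moreover have "0 \<le> (LINT \<omega>|M. indicator A \<omega> * (1 - D \<omega> * c))"
        using ae by (intro integral_nonneg_AE) (auto elim!: eventually_mono split: split_indicator)
      ultimately show "Q A * c \<le> prob A" using diff[of A] by simp
    qed
  }
qed

text \<open>The exceptional set is where D (1 - a) > 1; points with D = 0 never belong to it, since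
  1 - \<infinity> lies below every real. As D > 0 on this set, being null for Q and null for P is
  the same.\<close>

lemma dPdQ_constraint_iff:
  assumes Q: "has_density M Q D"
  shows "Q {\<omega>\<in>space M. ereal a < 1 - dPdQ D \<omega>} = 0 \<longleftrightarrow> (AE \<omega> in M. D \<omega> * (1 - a) \<le> 1)"
proof -
  have [measurable]: "D \<in> borel_measurable M" and Dint: "integrable M D"
    and Dnn: "\<And>\<omega>. \<omega> \<in> space M \<Longrightarrow> 0 \<le> D \<omega>"
    and QA: "\<And>A. A \<in> sets M \<Longrightarrow> Q A = (LINT \<omega>:A|M. D \<omega>)"
    using Q by (auto simp: has_density_def)
  define B where "B = {\<omega>\<in>space M. D \<omega> * (1 - a) > 1}"
  have B[measurable]: "B \<in> sets M" by (simp add: B_def)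
  have Bpos: "D \<omega> > 0" if "\<omega> \<in> B" for \<omega>
    using that Dnn[of \<omega>] by (cases "D \<omega> = 0") (auto simp: B_def)
  have "{\<omega>\<in>space M. ereal a < 1 - dPdQ D \<omega>} = B"
  proof -
    have "ereal a < 1 - dPdQ D \<omega> \<longleftrightarrow> D \<omega> * (1 - a) > 1" if "\<omega> \<in> space M" for \<omega>
      using Dnn[OF that] by (auto simp: dPdQ_def one_ereal_def field_simps)
    then show ?thesis by (auto simp: B_def)
  qed
  moreover have "Q B = 0 \<longleftrightarrow> (AE \<omega> in M. indicator B \<omega> * D \<omega> = 0)"
    unfolding QA[OF B] set_lebesgue_integral_def
    using integrable_mult_indicator[OF B Dint] Dnn
    by (subst integral_nonneg_eq_0_iff_AE) (auto split: split_indicator)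
  moreover have "(AE \<omega> in M. indicator B \<omega> * D \<omega> = 0) \<longleftrightarrow> (AE \<omega> in M. D \<omega> * (1 - a) \<le> 1)"
  proof (rule AE_cong)
    fix \<omega> assume "\<omega> \<in> space M"
    then show "indicator B \<omega> * D \<omega> = 0 \<longleftrightarrow> D \<omega> * (1 - a) \<le> 1"
      using Bpos[of \<omega>] by (auto simp: B_def split: split_indicator)
  qed
  ultimately show ?thesis by simp
qed

text \<open>The constraint on the density is a setwise domination of \<open>Q\<close> by \<open>P\<close>: this makes it
  convex and closed under setwise convergence.\<close>
lemma feasible_iff_dominated:
  assumes Q: "Q \<in> M1f M" and L: "\<Lambda> x \<le> 1"
  shows "feasible M \<Lambda> Q x \<longleftrightarrow> (\<forall>A\<in>sets M. Q A * (1 - \<Lambda> x) \<le> prob A)"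
proof (cases "\<Lambda> x = 1")
  case True
  then show ?thesis by (simp add: feasible_def)
next
  case False
  then have lt: "\<Lambda> x < 1" using L by simp
  have "feasible M \<Lambda> Q x \<longleftrightarrow> (\<exists>D. has_density M Q D \<and> (\<forall>A\<in>sets M. Q A * (1 - \<Lambda> x) \<le> prob A))"
    using False dPdQ_constraint_iff[of Q _ "\<Lambda> x"] density_bound_iff[of Q _ "1 - \<Lambda> x"]
    unfolding feasible_def by blast
  \<comment> \<open>The density need not be supplied separately: domination with the positive
    constant 1 - \<Lambda> x produces one.\<close>
  then show ?thesis
    using dominated_fa_has_density[OF Q, of "1 - \<Lambda> x"] lt by auto
qed

end

subsection \<open>The map \<open>R\<close>\<close>

lemma R_lower: "feasible M \<Lambda> Q x \<Longrightarrow> min t (ereal x) \<le> R M \<Lambda> t Q"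
  unfolding R_def by (intro SUP_upper) simp

lemma R_least: "(\<And>x. feasible M \<Lambda> Q x \<Longrightarrow> min t (ereal x) \<le> c) \<Longrightarrow> R M \<Lambda> t Q \<le> c"
  unfolding R_def by (intro SUP_least) simp

lemma R_le: "R M \<Lambda> t Q \<le> t"
  by (rule R_least) simp

lemma R_mono: "s \<le> t \<Longrightarrow> R M \<Lambda> s Q \<le> R M \<Lambda> t Q"
  by (rule R_least) (blast intro: order_trans[OF _ R_lower] min.mono)

text \<open>Since R never exceeds t, letting t decrease gives a value that does not depend on
  Q.\<close>

lemma INF_R: "(INF t::real. R M \<Lambda> (ereal t) Q) = - \<infinity>"
proof -
  have "(INF t::real. R M \<Lambda> (ereal t) Q) \<le> ereal B" for B
    by (rule INF_lower2[of B]) (auto intro: R_le)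
  then show ?thesis by (rule ereal_bot)
qed

text \<open>For each fixed x the map t to min t x is 1-Lipschitz, and the supremum over x keeps this
  bound.\<close>

lemma R_nonexpansive:
  assumes "t2 \<le> t1"
  shows "R M \<Lambda> (ereal t1) Q \<le> R M \<Lambda> (ereal t2) Q + ereal (t1 - t2)"
proof (rule R_least)
  fix x assume x: "feasible M \<Lambda> Q x"
  have "min (ereal t1) (ereal x) \<le> min (ereal t2) (ereal x) + ereal (t1 - t2)"
    using assms by (auto simp: min_def)
  also have "\<dots> \<le> R M \<Lambda> (ereal t2) Q + ereal (t1 - t2)"
    by (intro add_right_mono R_lower x)
  finally show "min (ereal t1) (ereal x) \<le> R M \<Lambda> (ereal t2) Q + ereal (t1 - t2)" .
qed

lemma M1f_nonneg: "Q \<in> M1f M \<Longrightarrow> 0 \<le> Q A"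
  by (cases "A \<in> sets M") (auto simp: M1f_def)

lemma M1f_convex:
  assumes "Q1 \<in> M1f M" "Q2 \<in> M1f M" "0 \<le> l" "l \<le> 1"
  shows "(\<lambda>A. l * Q1 A + (1 - l) * Q2 A) \<in> M1f M"
proof -
  have "0 \<le> l * Q1 A + (1 - l) * Q2 A" for A
    using assms M1f_nonneg by (intro add_nonneg_nonneg mult_nonneg_nonneg) auto
  then show ?thesis
    using assms(1,2) by (auto simp: M1f_def distrib_left)
qed

section \<open>Quasi-concavity and upper semicontinuity of \<open>R\<close>\<close>

context prob_space
begin

text \<open>A larger \<Lambda> weakens the domination constraint, so the feasible points form a
  down-closed set of reals.\<close>

lemma feasible_antimono:
  assumes "antimono \<Lambda>" "\<And>x. \<Lambda> x \<le> 1" "Q \<in> M1f M" "feasible M \<Lambda> Q y" "x \<le> y"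
  shows "feasible M \<Lambda> Q x"
proof -
  have "\<Lambda> y \<le> \<Lambda> x" using assms(1,5) by (auto dest: antimonoD)
  then have "Q A * (1 - \<Lambda> x) \<le> Q A * (1 - \<Lambda> y)" for A
    using M1f_nonneg[OF assms(3)] by (intro mult_left_mono) auto
  then show ?thesis
    using assms(2-4) by (auto simp: feasible_iff_dominated intro: order_trans)
qed

text \<open>The smaller of two points feasible for Q1 and Q2 is feasible for both, hence for the
  mixture, because domination is a convex condition.\<close>

lemma R_quasi_concave:
  assumes L: "antimono \<Lambda>" "\<And>x. \<Lambda> x \<le> 1"
    and Q: "Q1 \<in> M1f M" "Q2 \<in> M1f M" and l: "0 \<le> l" "l \<le> 1"
  shows "min (R M \<Lambda> (ereal t1) Q1) (R M \<Lambda> (ereal t2) Q2)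
    \<le> R M \<Lambda> (ereal (l * t1 + (1 - l) * t2)) (\<lambda>A. l * Q1 A + (1 - l) * Q2 A)"
    (is "_ \<le> R M \<Lambda> (ereal ?t) ?Q")
proof (rule dense_le)
  \<comment> \<open>The suprema defining R need not be attained, so the bound is proved for every z
    strictly below the minimum.\<close>
  fix z assume z: "z < min (R M \<Lambda> (ereal t1) Q1) (R M \<Lambda> (ereal t2) Q2)"
  then obtain x1 x2 where x: "feasible M \<Lambda> Q1 x1" "z < min (ereal t1) (ereal x1)"
     "feasible M \<Lambda> Q2 x2" "z < min (ereal t2) (ereal x2)"
    by (auto simp: R_def less_SUP_iff)
  define x where "x = min x1 x2"
  have "feasible M \<Lambda> Q1 x" "feasible M \<Lambda> Q2 x"
    using x by (auto simp: x_def intro: feasible_antimono[OF L] Q)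
  then have dom: "Q1 A * (1 - \<Lambda> x) \<le> prob A" "Q2 A * (1 - \<Lambda> x) \<le> prob A" if "A \<in> sets M" for A
    using that L(2) Q by (auto simp: feasible_iff_dominated)
  have "feasible M \<Lambda> ?Q x"
  proof (subst feasible_iff_dominated[OF M1f_convex[OF Q l], where \<Lambda>=\<Lambda> and x=x, OF L(2)], rule ballI)
    fix A assume A: "A \<in> sets M"
    have "l * (Q1 A * (1 - \<Lambda> x)) + (1 - l) * (Q2 A * (1 - \<Lambda> x)) \<le> prob A"
      using convex_bound_le[OF dom[OF A], of l "1 - l"] l by simp
    then show "?Q A * (1 - \<Lambda> x) \<le> prob A" by (simp add: algebra_simps)
  qed
  then have "min (ereal ?t) (ereal x) \<le> R M \<Lambda> (ereal ?t) ?Q"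
    by (rule R_lower)
  moreover have "min t1 t2 \<le> ?t"
  proof -
    have "l * min t1 t2 + (1 - l) * min t1 t2 \<le> ?t"
      using l by (intro add_mono mult_left_mono) auto
    then show ?thesis by (simp add: algebra_simps)
  qed
  moreover have "z \<le> min (ereal (min t1 t2)) (ereal x)"
    using x by (auto simp: x_def min_def)
  ultimately show "z \<le> R M \<Lambda> (ereal ?t) ?Q"
    by (meson ereal_less_eq(3) min.mono order_refl order_trans)
qed

text \<open>The topology on set functions is the product one, that is, setwise convergence. If t <
  c, the bound R \<le> t already gives a neighbourhood; otherwise the neighbourhood comes from a
  violated constraint.\<close>

lemma R_usc:
  assumes L: "antimono \<Lambda>" "\<And>x. \<Lambda> x \<le> 1"
  shows "usc_on (UNIV \<times> M1f M) (\<lambda>(t, Q). R M \<Lambda> (ereal t) Q)"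
  unfolding usc_on_def
proof (intro ballI allI impI, clarsimp)
  fix t :: real and Q and c :: ereal
  assume Q: "Q \<in> M1f M" and lt: "R M \<Lambda> (ereal t) Q < c"
  show "\<exists>U. open U \<and> (t, Q) \<in> U \<and> (\<forall>q\<in>U \<inter> UNIV \<times> M1f M. (case q of (t, Q) \<Rightarrow> R M \<Lambda> (ereal t) Q) < c)"
  proof (cases "ereal t < c")
    case True
    have "open (ereal -` {..<c} \<times> (UNIV :: ('a set \<Rightarrow> real) set))"
      by (intro open_Times open_UNIV open_vimage[OF open_lessThan] continuous_on_ereal continuous_on_id)
    moreover have "R M \<Lambda> (ereal s) Q' < c" if "ereal s < c" for s Q'
      using that R_le le_less_trans by blast
    ultimately show ?thesis using True
      by (intro exI[of _ "ereal -` {..<c} \<times> UNIV"]) auto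
  next
    case False
    \<comment> \<open>Here c \<le> t, so min t x = x; if x were feasible, R would be at least
      x.\<close>
    obtain x where x: "R M \<Lambda> (ereal t) Q < ereal x" "ereal x < c"
      using ereal_dense2[OF lt] by auto
    then have "\<not> feasible M \<Lambda> Q x"
      using R_lower[of M \<Lambda> Q x "ereal t"] False by (auto simp: min_def not_less split: if_splits)
    then obtain A where A: "A \<in> sets M" "prob A < Q A * (1 - \<Lambda> x)"
      using feasible_iff_dominated[where \<Lambda>=\<Lambda>, OF Q L(2)] by (auto simp: not_le)
    \<comment> \<open>A single set A witnesses infeasibility at x, so the violation is an open
      condition on one coordinate of Q. It persists on \<open>?V\<close>, where all feasible points
      then lie below x.\<close>
    let ?V = "{Q'. prob A < Q' A * (1 - \<Lambda> x)} :: ('a set \<Rightarrow> real) set"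
    have "open ?V"
      by (intro open_Collect_less continuous_on_const continuous_on_mult continuous_on_product_coordinates)
    moreover have "R M \<Lambda> (ereal s) Q' < c" if "Q' \<in> M1f M" "Q' \<in> ?V" for s Q'
    proof -
      have nf: "\<not> feasible M \<Lambda> Q' x"
        using that A feasible_iff_dominated[where \<Lambda>=\<Lambda>, OF that(1) L(2)] by (auto simp: not_le)
      have "R M \<Lambda> (ereal s) Q' \<le> ereal x"
      proof (rule R_least)
        fix y assume "feasible M \<Lambda> Q' y"
        then have "y < x" using feasible_antimono[OF L that(1), of y x] nf by fastforce
        then show "min (ereal s) (ereal y) \<le> ereal x" by (simp add: min_le_iff_disj)
      qed
      then show ?thesis using x(2) by (rule le_less_trans)
    qed
    ultimately show ?thesis using A
      by (intro exI[of _ "UNIV \<times> ?V"]) (auto intro: open_Times)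
  qed
qed

end

subsection \<open>Quantiles\<close>

text \<open>Allows the level to vary in the tail integral of \<open>VaR\<close>. Continuity is taken
  from the gauge integral, which agrees with the Lebesgue integral for integrable f.\<close>

lemma continuous_on_set_integral_lower_limit:
  fixes f :: "real \<Rightarrow> real"
  assumes int: "set_integrable lborel {c..d} f"
  shows "continuous_on {c..d} (\<lambda>a. LINT x:{a..d}|lborel. f x)"
proof (rule continuous_on_eq)
  show "continuous_on {c..d} (\<lambda>a. integral {a..d} f)"
    by (rule indefinite_integral_continuous_1'[OF set_borel_integral_eq_integral(1)[OF int]])
  fix a assume a: "a \<in> {c..d}"
  have "set_integrable lborel {a..d} f"
    by (rule set_integrable_subset[OF int]) (use a in auto)
  then show "integral {a..d} f = (LINT x:{a..d}|lborel. f x)"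
    by (rule set_borel_integral_eq_integral(2)[symmetric])
qed

section \<open>The quantile transform and the tail integral\<close>

context prob_space
begin

text \<open>Strictly between the levels 0 and 1, \<open>VaR\<close> is the pseudo-inverse
  \<open>D.I\<close> of the distribution function. It is monotone and, under the uniform law, has
  the law of X (the Skorokhod construction).\<close>

lemma
  assumes X[measurable]: "X \<in> borel_measurable M"
  shows quantile_mono: "mono_on {0<..<1} (\<lambda>\<beta>. real_of_ereal (VaR M \<beta> X))"
    and distr_quantile: "distr (restrict_space lborel {0<..<1}) borel (\<lambda>\<beta>. real_of_ereal (VaR M \<beta> X))
      = distr M borel X"
proof -
  interpret D: cdf_distribution "distr M borel X"
    unfolding cdf_distribution_def by (rule real_distribution_distr) simp
  have C: "D.C x = prob {\<omega>\<in>space M. X \<omega> \<le> x}" for x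
    by (simp add: cdf_def measure_distr vimage_def Int_def conj_commute)
  have VaR_I: "VaR M \<beta> X = ereal (D.I \<beta>)" if "0 < \<beta>" "\<beta> < 1" for \<beta>
  proof -
    have Inf_atLeast: "Inf (ereal ` {i..}) = ereal i" for i
      by (rule Inf_eqI) auto
    \<comment> \<open>The Galois connection between \<open>D.I\<close> and \<open>D.C\<close> turns
      this set into a closed half-line, whose infimum is its endpoint.\<close>
    have "{ereal x | x. prob {\<omega>\<in>space M. X \<omega> \<le> x} \<ge> \<beta>} = ereal ` {x. \<beta> \<le> D.C x}"
      unfolding C by blast
    also have "{x. \<beta> \<le> D.C x} = {D.I \<beta>..}"
      unfolding atLeast_def by (intro Collect_cong D.pseudoinverse that)
    finally show ?thesis
      unfolding VaR_def by (simp only: Inf_atLeast)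
  qed
  show "mono_on {0<..<1} (\<lambda>\<beta>. real_of_ereal (VaR M \<beta> X))"
    using D.mono_I by (auto simp: mono_on_def VaR_I)
  have "distr (restrict_space lborel {0<..<1}) borel (\<lambda>\<beta>. real_of_ereal (VaR M \<beta> X))
      = distr (restrict_space lborel {0<..<1}) borel D.I"
    by (intro distr_cong) (auto simp: VaR_I space_restrict_space)
  then show "distr (restrict_space lborel {0<..<1}) borel (\<lambda>\<beta>. real_of_ereal (VaR M \<beta> X))
      = distr M borel X"
    by (simp add: D.distr_I_eq_M)
qed

context
  fixes X :: "'a \<Rightarrow> real"
  assumes X[measurable]: "X \<in> borel_measurable M"
begin

text \<open>The open unit interval omits the levels 0 and 1, where \<open>VaR\<close> may be
  infinite and \<open>real_of_ereal\<close> would then return the default 0.\<close>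

private abbreviation "T \<equiv> restrict_space lborel {0<..<1::real}"
private abbreviation "q \<equiv> \<lambda>\<beta>. real_of_ereal (VaR M \<beta> X)"

private lemma quantile_measurable[measurable]: "q \<in> borel_measurable T"
proof -
  have "q \<in> borel_measurable (restrict_space borel {0<..<1})"
    by (intro borel_measurable_mono_on_fnc quantile_mono X)
  then show ?thesis
    by (subst measurable_cong_sets[of _ "restrict_space borel {0<..<1}"])
      (auto simp: sets_restrict_space)
qed

private lemma quantile_sets:
  assumes "S \<in> sets borel"
  shows "{\<beta>\<in>space T. q \<beta> \<in> S} \<in> sets T"
proof -
  have "{\<beta>\<in>space T. q \<beta> \<in> S} = q -` S \<inter> space T" by blast
  then show ?thesis using measurable_sets[OF quantile_measurable assms] by (simp only:)
qed

private lemma T_prob: "prob_space T"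
  by (auto simp: emeasure_restrict_space space_restrict_space intro!: prob_spaceI)

lemma integral_quantile:
  fixes g :: "real \<Rightarrow> real"
  assumes g: "g \<in> borel_measurable borel"
  shows "(LINT \<beta>|T. g (q \<beta>)) = (LINT \<omega>|M. g (X \<omega>))"
    and "integrable T (\<lambda>\<beta>. g (q \<beta>)) \<longleftrightarrow> integrable M (\<lambda>\<omega>. g (X \<omega>))"
proof -
  have "(LINT \<beta>|T. g (q \<beta>)) = integral\<^sup>L (distr T borel q) g"
    by (rule integral_distr[OF quantile_measurable g, symmetric])
  also have "\<dots> = integral\<^sup>L (distr M borel X) g"
    by (simp only: distr_quantile[OF X])
  also have "\<dots> = (LINT \<omega>|M. g (X \<omega>))"
    by (rule integral_distr[OF X g])
  finally show "(LINT \<beta>|T. g (q \<beta>)) = (LINT \<omega>|M. g (X \<omega>))" .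
  have "integrable T (\<lambda>\<beta>. g (q \<beta>)) \<longleftrightarrow> integrable (distr T borel q) g"
    by (rule integrable_distr_eq[OF quantile_measurable g, symmetric])
  also have "\<dots> \<longleftrightarrow> integrable (distr M borel X) g"
    by (simp only: distr_quantile[OF X])
  also have "\<dots> \<longleftrightarrow> integrable M (\<lambda>\<omega>. g (X \<omega>))"
    by (rule integrable_distr_eq[OF X g])
  finally show "integrable T (\<lambda>\<beta>. g (q \<beta>)) \<longleftrightarrow> integrable M (\<lambda>\<omega>. g (X \<omega>))" .
qed

lemma prob_quantile:
  assumes "S \<in> sets borel"
  shows "prob {\<omega>\<in>space M. X \<omega> \<in> S} = measure T {\<beta>\<in>space T. q \<beta> \<in> S}"
proof -
  have "measure (distr M borel X) S = measure (distr T borel q) S"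
    by (simp only: distr_quantile[OF X])
  then show ?thesis
    using assms by (simp add: measure_distr vimage_def Int_def conj_commute)
qed

text \<open>By monotonicity, levels whose quantile exceeds \<open>q a\<close> lie above a, and all
  levels from a on have quantile at least \<open>q a\<close>; both intervals have length 1 -
  a.\<close>

lemma VaR_tail_bounds:
  assumes a: "0 < a" "a < 1"
  shows "prob {\<omega>\<in>space M. X \<omega> > q a} \<le> 1 - a" and "1 - a \<le> prob {\<omega>\<in>space M. X \<omega> \<ge> q a}"
proof -
  interpret T: prob_space T by (rule T_prob)
  have mono: "q \<beta> \<le> q \<gamma>" if "0 < \<beta>" "\<beta> \<le> \<gamma>" "\<gamma> < 1" for \<beta> \<gamma>
    using that mono_onD[OF quantile_mono[OF X], of \<beta> \<gamma>] by simp
  have *: "measure T {a<..<1} = 1 - a" "measure T {a..<1} = 1 - a"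
    using a by (subst measure_restrict_space, auto)+
  have sub: "{a<..<1} \<in> sets T" "{a..<1} \<in> sets T"
    using a by (auto simp: sets_restrict_space_iff)
  have "{\<beta>\<in>space T. q \<beta> \<in> {q a<..}} \<subseteq> {a<..<1}"
    using mono[of _ a] a by (force simp: space_restrict_space)
  then have "measure T {\<beta>\<in>space T. q \<beta> \<in> {q a<..}} \<le> measure T {a<..<1}"
    by (rule T.finite_measure_mono[OF _ sub(1)])
  then show "prob {\<omega>\<in>space M. X \<omega> > q a} \<le> 1 - a"
    using prob_quantile[of "{q a<..}"] * by simp
  have "{a..<1} \<subseteq> {\<beta>\<in>space T. q \<beta> \<in> {q a..}}"
    using mono[of a] a by (auto simp: space_restrict_space)
  then have "measure T {a..<1} \<le> measure T {\<beta>\<in>space T. q \<beta> \<in> {q a..}}"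
    by (rule T.finite_measure_mono) (rule quantile_sets, simp)
  then show "1 - a \<le> prob {\<omega>\<in>space M. X \<omega> \<ge> q a}"
    using prob_quantile[of "{q a..}"] * by simp
qed

text \<open>The two integrands can differ only at the levels 0 and 1, which form a null set;
  changing finitely many values also keeps measurability.\<close>

lemma VaR_integral_eq_quantile:
  assumes "0 \<le> a"
  shows "(LINT \<beta>:{a..1}|lborel. q \<beta>) = (LINT \<beta>|T. indicator {a..} \<beta> * q \<beta>)"
proof -
  let ?f = "\<lambda>\<beta>. indicator {a..1} \<beta> *\<^sub>R q \<beta>" and ?g = "\<lambda>\<beta>. indicator {0<..<1} \<beta> *\<^sub>R (indicator {a..} \<beta> * q \<beta>)"
  have "(\<lambda>\<beta>. indicator {a..} \<beta> :: real) \<in> borel_measurable T"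
    by (rule measurable_restrict_space1) simp
  then have "(\<lambda>\<beta>. indicator {a..} \<beta> * q \<beta>) \<in> borel_measurable T"
    by (rule borel_measurable_times[OF _ quantile_measurable])
  then have g: "?g \<in> borel_measurable lborel"
    by (subst borel_measurable_restrict_space_iff[symmetric]) simp_all
  then have f: "?f \<in> borel_measurable lborel"
    by (rule measurable_discrete_difference[where X="{0,1}"])
      (use assms in \<open>auto split: split_indicator\<close>)
  have "AE \<beta> in lborel. \<beta> \<noteq> 0 \<and> \<beta> \<noteq> (1::real)"
    by (auto intro!: AE_lborel_singleton simp: eventually_conj_iff)
  then have "AE \<beta> in lborel. ?f \<beta> = ?g \<beta>"
    by eventually_elim (use assms in \<open>auto split: split_indicator\<close>)
  then have "(LINT \<beta>|lborel. ?f \<beta>) = (LINT \<beta>|lborel. ?g \<beta>)"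
    using f g by (intro integral_cong_AE)
  then show ?thesis
    by (simp add: set_lebesgue_integral_def integral_restrict_space)
qed

lemma VaR_set_integrable:
  assumes "integrable M X"
  shows "set_integrable lborel {0..1} q"
proof -
  let ?f = "\<lambda>\<beta>. indicator {0..1} \<beta> *\<^sub>R q \<beta>" and ?g = "\<lambda>\<beta>. indicator {0<..<1} \<beta> *\<^sub>R q \<beta>"
  have "integrable T q"
    using integral_quantile(2)[of "\<lambda>x. x"] assms by simp
  then have g: "integrable lborel ?g"
    by (subst integrable_restrict_space[symmetric]) auto
  have f: "?f \<in> borel_measurable lborel"
    by (rule measurable_discrete_difference[where X="{0,1}" and f="?g"])
      (use g in \<open>auto split: split_indicator\<close>)
  have "AE \<beta> in lborel. \<beta> \<noteq> 0 \<and> \<beta> \<noteq> (1::real)"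
    by (auto intro!: AE_lborel_singleton simp: eventually_conj_iff)
  then have "AE \<beta> in lborel. ?g \<beta> = ?f \<beta>"
    by eventually_elim (auto split: split_indicator)
  then show ?thesis
    unfolding set_integrable_def by (rule integrable_cong_AE_imp[OF g f])
qed

lemma VaR_integral_continuous:
  assumes "integrable M X"
  shows "continuous_on {0..1} (\<lambda>a. LINT \<beta>:{a..1}|lborel. q \<beta>)"
  by (rule continuous_on_set_integral_lower_limit[OF VaR_set_integrable[OF assms]])

lemma VaR_integral_0: "(LINT \<beta>:{0..1}|lborel. q \<beta>) = expectation X"
proof -
  have "(LINT \<beta>:{0..1}|lborel. q \<beta>) = (LINT \<beta>|T. q \<beta>)"
    unfolding VaR_integral_eq_quantile[OF order_refl]
    by (intro Bochner_Integration.integral_cong) (auto simp: space_restrict_space split: split_indicator)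
  then show ?thesis using integral_quantile(1)[of "\<lambda>x. x"] by simp
qed

text \<open>From level a on, the quantile is \<open>q a\<close> plus its excess, and below a the
  excess vanishes. After division by 1 - a this is the Rockafellar-Uryasev form of
  \<open>ES\<close>, in which X enters through an ordinary expectation.\<close>

lemma VaR_integral_eq:
  assumes int: "integrable M X" and a: "0 < a" "a < 1"
  shows "(LINT \<beta>:{a..1}|lborel. q \<beta>) = (1 - a) * q a + expectation (\<lambda>\<omega>. max (X \<omega> - q a) 0)"
proof -
  interpret T: prob_space T by (rule T_prob)
  have mono: "q \<beta> \<le> q \<gamma>" if "0 < \<beta>" "\<beta> \<le> \<gamma>" "\<gamma> < 1" for \<beta> \<gamma>
    using that mono_onD[OF quantile_mono[OF X], of \<beta> \<gamma>] by simp
  have S: "{a..<1} \<in> sets T" using a by (auto simp: sets_restrict_space_iff)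
  have m: "measure T {a..<1} = 1 - a" using a by (subst measure_restrict_space) auto
  have sub: "{a..<1} \<subseteq> {0<..<1}" using a by auto
  have intT: "integrable T (\<lambda>\<beta>. max (q \<beta> - q a) 0)"
    using int by (subst integral_quantile(2)[of "\<lambda>x. max (x - q a) 0"]) auto
  have "(LINT \<beta>|T. indicator {a..} \<beta> * q \<beta>)
      = (LINT \<beta>|T. q a * indicator {a..<1} \<beta> + max (q \<beta> - q a) 0)"
  proof (intro Bochner_Integration.integral_cong refl)
    fix \<beta> assume "\<beta> \<in> space T"
    then have \<beta>: "0 < \<beta>" "\<beta> < 1" by (auto simp: space_restrict_space)
    show "indicator {a..} \<beta> * q \<beta> = q a * indicator {a..<1} \<beta> + max (q \<beta> - q a) 0"
      using \<beta> a mono[of a \<beta>] mono[of \<beta> a] by (cases "a \<le> \<beta>") simp_all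
  qed
  also have "\<dots> = q a * (1 - a) + (LINT \<beta>|T. max (q \<beta> - q a) 0)"
    using S intT m Int_absorb2[OF sub]
    by (subst Bochner_Integration.integral_add)
      (auto simp: T.emeasure_eq_measure space_restrict_space)
  also have "(LINT \<beta>|T. max (q \<beta> - q a) 0) = expectation (\<lambda>\<omega>. max (X \<omega> - q a) 0)"
    by (rule integral_quantile(1)[of "\<lambda>x. max (x - q a) 0"]) simp
  finally show ?thesis
    using a by (simp add: VaR_integral_eq_quantile mult.commute)
qed

end
end

subsection \<open>Finitely additive probabilities\<close>

lemma M1f_additive:
  "Q \<in> M1f M \<Longrightarrow> A \<in> sets M \<Longrightarrow> B \<in> sets M \<Longrightarrow> A \<inter> B = {} \<Longrightarrow> Q (A \<union> B) = Q A + Q B"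
  by (auto simp: M1f_def)

lemma M1f_mono:
  assumes Q: "Q \<in> M1f M" and "A \<in> sets M" "B \<in> sets M" "A \<subseteq> B"
  shows "Q A \<le> Q B"
proof -
  have "Q (A \<union> (B - A)) = Q A + Q (B - A)"
    using assms by (intro M1f_additive[OF Q]) auto
  moreover have "A \<union> (B - A) = B" using assms by auto
  ultimately show ?thesis using M1f_nonneg[OF Q, of "B - A"] by simp
qed

lemma M1f_le_1:
  assumes Q: "Q \<in> M1f M"
  shows "Q A \<le> 1"
proof (cases "A \<in> sets M")
  case True
  then show ?thesis
    using M1f_mono[OF Q True sets.top] Q by (auto simp: M1f_def dest: sets.sets_into_space)
qed (use Q in \<open>auto simp: M1f_def\<close>)

text \<open>X is compared with the constant x layer by layer: upper layers vanish from x on, and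
  lower layers have full mass below -x. The two integrals are thus bounded by the positive and
  negative parts of x.\<close>

lemma fa_expect_le:
  assumes Q: "Q \<in> M1f M" and [measurable]: "X \<in> borel_measurable M"
    and x: "Q {\<omega>\<in>space M. x < X \<omega>} = 0"
  shows "fa_expect M Q X \<le> ereal x"
proof -
  have 0: "Q {\<omega>\<in>space M. s < X \<omega>} = 0" if "x \<le> s" for s
  proof -
    have "Q {\<omega>\<in>space M. s < X \<omega>} \<le> Q {\<omega>\<in>space M. x < X \<omega>}"
      using that by (intro M1f_mono[OF Q]) auto
    then show ?thesis using x M1f_nonneg[OF Q] by (simp add: antisym)
  qed
  have 1: "1 \<le> Q {\<omega>\<in>space M. X \<omega> < - s}" if "s < - x" for s
  proof -
    have "Q ({\<omega>\<in>space M. x < X \<omega>} \<union> {\<omega>\<in>space M. X \<omega> \<le> x})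
        = Q {\<omega>\<in>space M. x < X \<omega>} + Q {\<omega>\<in>space M. X \<omega> \<le> x}"
      by (intro M1f_additive[OF Q]) auto
    also have "{\<omega>\<in>space M. x < X \<omega>} \<union> {\<omega>\<in>space M. X \<omega> \<le> x} = space M" by auto
    finally have "Q {\<omega>\<in>space M. X \<omega> \<le> x} = 1" using x Q by (simp add: M1f_def)
    moreover have "Q {\<omega>\<in>space M. X \<omega> \<le> x} \<le> Q {\<omega>\<in>space M. X \<omega> < - s}"
      using that by (intro M1f_mono[OF Q]) auto
    ultimately show ?thesis by simp
  qed
  have "(\<integral>\<^sup>+ s. indicator {0..} s * ennreal (Q {\<omega>\<in>space M. s < X \<omega>}) \<partial>lborel)
      \<le> (\<integral>\<^sup>+ s. indicator {0..<x} s \<partial>lborel)"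
    using 0 M1f_le_1[OF Q] by (intro nn_integral_mono) (auto simp: not_less split: split_indicator)
  also have "\<dots> = ennreal x"
    by (cases "0 \<le> x") (auto simp: ennreal_neg)
  finally have p: "(\<integral>\<^sup>+ s. indicator {0..} s * ennreal (Q {\<omega>\<in>space M. s < X \<omega>}) \<partial>lborel) \<le> ennreal x" .
  have "ennreal (- x) = (\<integral>\<^sup>+ s. indicator {0..<- x} s \<partial>lborel)"
    by (cases "0 \<le> - x") (auto simp: ennreal_neg)
  also have "\<dots> \<le> (\<integral>\<^sup>+ s. indicator {0..} s * ennreal (Q {\<omega>\<in>space M. X \<omega> < - s}) \<partial>lborel)"
    using 1 by (intro nn_integral_mono) (auto split: split_indicator)
  finally have n: "ennreal (- x) \<le> (\<integral>\<^sup>+ s. indicator {0..} s * ennreal (Q {\<omega>\<in>space M. X \<omega> < - s}) \<partial>lborel)" .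
  have "fa_expect M Q X \<le> enn2ereal (ennreal x) - enn2ereal (ennreal (- x))"
    unfolding fa_expect_def by (intro ereal_minus_mono) (use p n in \<open>auto simp: less_eq_ennreal.rep_eq\<close>)
  also have "\<dots> = ereal x"
    by (cases "0 \<le> x") (auto simp: ennreal_neg enn2ereal_ennreal zero_ennreal.rep_eq)
  finally show ?thesis .
qed

text \<open>The mirror image of \<open>fa_expect_le\<close>, with the roles of the two layer
  integrals exchanged.\<close>

lemma fa_expect_ge:
  assumes Q: "Q \<in> M1f M" and [measurable]: "X \<in> borel_measurable M"
    and x: "Q {\<omega>\<in>space M. x < X \<omega>} = 1"
  shows "ereal x \<le> fa_expect M Q X"
proof -
  have 1: "1 \<le> Q {\<omega>\<in>space M. s < X \<omega>}" if "s < x" for s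
  proof -
    have "Q {\<omega>\<in>space M. x < X \<omega>} \<le> Q {\<omega>\<in>space M. s < X \<omega>}"
      using that by (intro M1f_mono[OF Q]) auto
    then show ?thesis using x by simp
  qed
  have 0: "Q {\<omega>\<in>space M. X \<omega> < - s} = 0" if "- x \<le> s" for s
  proof -
    have "Q ({\<omega>\<in>space M. x < X \<omega>} \<union> {\<omega>\<in>space M. X \<omega> < - s})
        = Q {\<omega>\<in>space M. x < X \<omega>} + Q {\<omega>\<in>space M. X \<omega> < - s}"
      using that by (intro M1f_additive[OF Q]) auto
    then show ?thesis
      using M1f_le_1[OF Q, of "{\<omega>\<in>space M. x < X \<omega>} \<union> {\<omega>\<in>space M. X \<omega> < - s}"] x
        M1f_nonneg[OF Q, of "{\<omega>\<in>space M. X \<omega> < - s}"] by simp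
  qed
  have "(\<integral>\<^sup>+ s. indicator {0..} s * ennreal (Q {\<omega>\<in>space M. X \<omega> < - s}) \<partial>lborel)
      \<le> (\<integral>\<^sup>+ s. indicator {0..<- x} s \<partial>lborel)"
    using 0 M1f_le_1[OF Q] by (intro nn_integral_mono) (auto simp: not_less split: split_indicator)
  also have "\<dots> = ennreal (- x)"
    by (cases "0 \<le> - x") (auto simp: ennreal_neg)
  finally have n: "(\<integral>\<^sup>+ s. indicator {0..} s * ennreal (Q {\<omega>\<in>space M. X \<omega> < - s}) \<partial>lborel) \<le> ennreal (- x)" .
  have "ennreal x = (\<integral>\<^sup>+ s. indicator {0..<x} s \<partial>lborel)"
    by (cases "0 \<le> x") (auto simp: ennreal_neg)
  also have "\<dots> \<le> (\<integral>\<^sup>+ s. indicator {0..} s * ennreal (Q {\<omega>\<in>space M. s < X \<omega>}) \<partial>lborel)"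
    using 1 by (intro nn_integral_mono) (auto split: split_indicator)
  finally have p: "ennreal x \<le> (\<integral>\<^sup>+ s. indicator {0..} s * ennreal (Q {\<omega>\<in>space M. s < X \<omega>}) \<partial>lborel)" .
  have "ereal x = enn2ereal (ennreal x) - enn2ereal (ennreal (- x))"
    by (cases "0 \<le> x") (auto simp: ennreal_neg enn2ereal_ennreal zero_ennreal.rep_eq)
  also have "\<dots> \<le> fa_expect M Q X"
    unfolding fa_expect_def by (intro ereal_minus_mono) (use p n in \<open>auto simp: less_eq_ennreal.rep_eq\<close>)
  finally show ?thesis .
qed

text \<open>Tychonoff: the set lies in a product of unit intervals, and each defining condition
  involves finitely many coordinates, hence is closed.\<close>

lemma compact_M1f: "compact (M1f M)"
proof -
  have "compactin (product_topology (\<lambda>_. euclidean) UNIV) (PiE UNIV (\<lambda>_::'a set. {0..1::real}))"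
    by (simp add: compactin_PiE)
  then have K: "compact (PiE UNIV (\<lambda>_::'a set. {0..1::real}))"
    by (simp add: euclidean_product_topology)
  have M1f_eq: "M1f M = (\<Inter>A\<in>- sets M. {Q. Q A = 0}) \<inter> (\<Inter>A\<in>sets M. {Q. 0 \<le> Q A})
      \<inter> {Q. Q (space M) = 1}
      \<inter> (\<Inter>A\<in>sets M. \<Inter>B\<in>{B\<in>sets M. A \<inter> B = {}}. {Q. Q (A \<union> B) = Q A + Q B})
      \<inter> (\<Inter>A\<in>{A\<in>sets M. measure M A = 0}. {Q. Q A = 0})"
    by (auto simp: M1f_def)
  have "closed (M1f M)"
    unfolding M1f_eq
    by (intro closed_Int closed_INT ballI closed_Collect_eq closed_Collect_le
        continuous_on_const continuous_on_add continuous_on_product_coordinates)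
  moreover have "M1f M \<subseteq> PiE UNIV (\<lambda>_. {0..1})"
    by (auto simp: M1f_nonneg M1f_le_1)
  ultimately show ?thesis
    using compact_Int_closed[OF K] by (metis inf.absorb_iff2)
qed

section \<open>Construction of extremal measures\<close>

context prob_space
begin

text \<open>The zero branch is the normalization off the sigma-algebra that \<open>M1f\<close>
  imposes.\<close>

lemma density_in_M1f:
  assumes D: "integrable M D" "\<And>\<omega>. \<omega> \<in> space M \<Longrightarrow> 0 \<le> D \<omega>" "expectation D = 1"
  defines "Q \<equiv> \<lambda>A. if A \<in> sets M then LINT \<omega>:A|M. D \<omega> else 0"
  shows "Q \<in> M1f M" and "has_density M Q D"
proof -
  have int: "set_integrable M A D" if "A \<in> sets M" for A
    using integrable_mult_indicator[OF that D(1)] by (simp add: set_integrable_def)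
  have "Q (space M) = (LINT \<omega>|M. D \<omega>)"
    by (simp add: Q_def set_lebesgue_integral_def) (auto intro!: Bochner_Integration.integral_cong)
  then have 1: "Q (space M) = 1" by (simp add: D)
  have 2: "0 \<le> Q A" for A
    using D(2) by (auto simp: Q_def set_lebesgue_integral_def intro!: integral_nonneg_AE)
  have 3: "Q A = 0" if "A \<in> sets M" "prob A = 0" for A
  proof -
    have "AE \<omega> in M. \<omega> \<notin> A"
      using that by (intro AE_not_in) (simp add: null_sets_def emeasure_eq_measure)
    then show ?thesis
      by (auto simp: Q_def set_lebesgue_integral_def intro!: integral_eq_zero_AE elim!: eventually_mono)
  qed
  have 4: "Q (A \<union> B) = Q A + Q B" if "A \<in> sets M" "B \<in> sets M" "A \<inter> B = {}" for A B
    using that set_integral_Un[OF that(3) int int] by (simp add: Q_def)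
  show "Q \<in> M1f M"
    using 1 2 3 4 by (simp add: M1f_def) (simp add: Q_def)
  show "has_density M Q D"
    using D by (auto simp: has_density_def Q_def)
qed

lemma prob_in_M1f: "prob \<in> M1f M"
  by (auto simp: M1f_def measure_notin_sets prob_space finite_measure_Union)

text \<open>\<open>VaR M 1 X\<close> is the essential supremum, possibly infinite. If it is not
  attained with positive probability, no countably additive Q has full mass on all these sets, since
  their intersection is null. Compactness supplies a finitely additive one.\<close>

lemma exists_concentrated_near_ess_sup:
  assumes [measurable]: "X \<in> borel_measurable M"
  shows "\<exists>Q\<in>M1f M. \<forall>s. ereal s < VaR M 1 X \<longrightarrow> Q {\<omega>\<in>space M. s < X \<omega>} = 1"
proof -
  let ?K = "\<lambda>s. {Q. Q {\<omega>\<in>space M. s < X \<omega>} = (1::real)}"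
  have ne: "\<exists>Q\<in>M1f M. Q \<in> ?K s" if s: "ereal s < VaR M 1 X" for s
  proof -
    define A where "A = {\<omega>\<in>space M. s < X \<omega>}"
    have A[measurable]: "A \<in> sets M" by (simp add: A_def)
    have "prob A \<noteq> 0"
    proof
      assume "prob A = 0"
      then have "prob (space M - A) = 1" using prob_compl[OF A] by simp
      also have "space M - A = {\<omega>\<in>space M. X \<omega> \<le> s}" by (auto simp: A_def)
      finally have "VaR M 1 X \<le> ereal s"
        unfolding VaR_def by (intro Inf_lower) auto
      then show False using s by simp
    qed
    then have pos: "prob A > 0" by (simp add: zero_less_measure_iff)
    \<comment> \<open>The density of P conditioned on A.\<close>
    let ?D = "\<lambda>\<omega>. indicator A \<omega> / prob A"
    have D: "integrable M ?D" "\<And>\<omega>. \<omega> \<in> space M \<Longrightarrow> 0 \<le> ?D \<omega>" "expectation ?D = 1"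
      using pos by (auto simp: emeasure_eq_measure)
    have "(LINT \<omega>:A|M. ?D \<omega>) = expectation ?D"
      unfolding set_lebesgue_integral_def
      by (intro Bochner_Integration.integral_cong) (auto split: split_indicator)
    then show ?thesis
      using density_in_M1f(1)[OF D] D(3) A by (intro bexI) (auto simp: A_def)
  qed
  have "M1f M \<inter> (\<Inter>s\<in>{s. ereal s < VaR M 1 X}. ?K s) \<noteq> {}"
  proof (rule compact_imp_fip_image[OF compact_M1f])
    show "closed (?K s)" for s
      by (intro closed_Collect_eq continuous_on_const continuous_on_product_coordinates)
    fix I assume I: "finite I" "I \<subseteq> {s. ereal s < VaR M 1 X}"
    show "M1f M \<inter> (\<Inter>s\<in>I. ?K s) \<noteq> {}"
    proof (cases "I = {}")
      case True
      then show ?thesis using prob_in_M1f by auto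
    next
      case False
      \<comment> \<open>The sets {s < X} shrink as s grows, so the largest of finitely many levels
        controls the others.\<close>
      then have "Max I \<in> I" using I by simp
      then obtain Q where Q: "Q \<in> M1f M" "Q \<in> ?K (Max I)" using ne I by blast
      have "Q \<in> ?K s" if "s \<in> I" for s
      proof -
        have "Q {\<omega>\<in>space M. Max I < X \<omega>} \<le> Q {\<omega>\<in>space M. s < X \<omega>}"
          using Max_ge[OF I(1) that] by (intro M1f_mono[OF Q(1)]) auto
        then show ?thesis using Q(2) M1f_le_1[OF Q(1)] by (auto intro: antisym)
      qed
      then show ?thesis using Q(1) by blast
    qed
  qed
  then show ?thesis by blast
qed


subsection \<open>Dual representation of \<open>ES\<close>\<close>

lemma ES_eq_VaR_plus_tail:
  assumes "integrable M X" "0 < a" "a < 1"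
  shows "ES M a X = ereal (real_of_ereal (VaR M a X)
    + expectation (\<lambda>\<omega>. max (X \<omega> - real_of_ereal (VaR M a X)) 0) / (1 - a))"
  using assms VaR_integral_eq[of X a] by (simp add: ES_def field_simps)

lemma ES_0: "integrable M X \<Longrightarrow> ES M 0 X = ereal (expectation X)"
  by (simp add: ES_def VaR_integral_0)

text \<open>The inequality D (X - q) \<le> max (X - q) 0 / (1 - a) is integrated using that D has
  mean 1. At level 1 every almost sure upper bound of X bounds the expectation by absolute
  continuity; at level 0, where \<open>VaR\<close> is no usable quantile, D must be 1.\<close>

lemma fa_expect_le_ES:
  assumes X: "integrable M X" and Q: "Q \<in> M1f M" and a: "0 \<le> a" "a \<le> 1"
    and dom: "\<And>A. A \<in> sets M \<Longrightarrow> Q A * (1 - a) \<le> prob A"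
  shows "fa_expect M Q X \<le> ES M a X"
proof (cases "a = 1")
  case True
  have [measurable]: "X \<in> borel_measurable M" using X by auto
  have "fa_expect M Q X \<le> ereal x" if "1 \<le> prob {\<omega>\<in>space M. X \<omega> \<le> x}" for x
  proof (rule fa_expect_le[OF Q])
    have "prob (space M - {\<omega>\<in>space M. X \<omega> \<le> x}) = 0"
      using that by (subst prob_compl) (auto intro: antisym)
    also have "space M - {\<omega>\<in>space M. X \<omega> \<le> x} = {\<omega>\<in>space M. x < X \<omega>}" by auto
    finally show "Q {\<omega>\<in>space M. x < X \<omega>} = 0" using Q by (auto simp: M1f_def)
  qed simp
  then show ?thesis
    using True by (auto simp: ES_def VaR_def intro!: Inf_greatest)
next
  case False
  then have a1: "0 < 1 - a" using a by simp
  obtain D where Q_D: "has_density M Q D"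
    using dominated_fa_has_density[OF Q a1 dom] by blast
  then have bound: "AE \<omega> in M. D \<omega> * (1 - a) \<le> 1"
    using density_bound_iff dom by blast
  have Dint: "integrable M D" and Dnn: "\<And>\<omega>. \<omega> \<in> space M \<Longrightarrow> 0 \<le> D \<omega>"
    and "Q (space M) = (LINT \<omega>:space M|M. D \<omega>)"
    using Q_D by (auto simp: has_density_def)
  moreover have "(LINT \<omega>:space M|M. D \<omega>) = expectation D"
    unfolding set_lebesgue_integral_def by (intro Bochner_Integration.integral_cong) auto
  ultimately have D1: "expectation D = 1" using Q by (simp add: M1f_def)
  have [measurable]: "X \<in> borel_measurable M" "D \<in> borel_measurable M" using X Dint by auto
  have DX: "integrable M (\<lambda>\<omega>. D \<omega> * X \<omega>)"
  proof (rule Bochner_Integration.integrable_bound)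
    show "integrable M (\<lambda>\<omega>. X \<omega> / (1 - a))" using X by simp
    show "AE \<omega> in M. norm (D \<omega> * X \<omega>) \<le> norm (X \<omega> / (1 - a))"
      using bound AE_space
    proof eventually_elim
      case (elim \<omega>)
      then have "D \<omega> * (1 - a) * \<bar>X \<omega>\<bar> \<le> 1 * \<bar>X \<omega>\<bar>" by (intro mult_right_mono) auto
      then show ?case using a1 Dnn elim by (simp add: abs_mult field_simps)
    qed
  qed simp
  have fa: "fa_expect M Q X = ereal (LINT \<omega>|M. D \<omega> * X \<omega>)"
    by (rule fa_expect_density[OF Q_D _ DX]) simp
  show ?thesis
  proof (cases "a = 0")
    case True
    \<comment> \<open>A density bounded by 1 with mean 1 equals 1 almost everywhere.\<close>
    have "AE \<omega> in M. 0 \<le> 1 - D \<omega>" using bound True by simp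
    moreover have "expectation (\<lambda>\<omega>. 1 - D \<omega>) = 0" using Dint D1 by (simp add: prob_space)
    ultimately have "AE \<omega> in M. 1 - D \<omega> = 0"
      using Dint by (subst (asm) integral_nonneg_eq_0_iff_AE) auto
    then have "(LINT \<omega>|M. D \<omega> * X \<omega>) = expectation X"
      by (intro integral_cong_AE) (auto elim!: eventually_mono)
    then show ?thesis using True fa ES_0[OF X] by simp
  next
    case False
    define q where "q = real_of_ereal (VaR M a X)"
    have tail: "integrable M (\<lambda>\<omega>. max (X \<omega> - q) 0)" using X by auto
    have "(LINT \<omega>|M. D \<omega> * X \<omega>) - q = (LINT \<omega>|M. D \<omega> * X \<omega> - q * D \<omega>)"
      using DX Dint D1 by simp
    also have "\<dots> \<le> (LINT \<omega>|M. max (X \<omega> - q) 0 / (1 - a))"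
    proof (rule integral_mono_AE)
      show "AE \<omega> in M. D \<omega> * X \<omega> - q * D \<omega> \<le> max (X \<omega> - q) 0 / (1 - a)"
        using bound AE_space
      proof eventually_elim
        case (elim \<omega>)
        have "D \<omega> * (1 - a) * (X \<omega> - q) \<le> D \<omega> * (1 - a) * max (X \<omega> - q) 0"
          using Dnn elim a1 by (intro mult_left_mono) auto
        also have "\<dots> \<le> 1 * max (X \<omega> - q) 0"
          using elim by (intro mult_right_mono) auto
        finally show ?case using a1 by (simp add: field_simps)
      qed
    qed (use DX Dint tail in auto)
    finally show ?thesis
      using fa ES_eq_VaR_plus_tail[OF X] False a a1 by (simp add: q_def)
  qed
qed

lemma ES_attained:
  assumes X: "integrable M X" and a: "0 \<le> a" "a \<le> 1"
  shows "\<exists>Q\<in>M1f M. (\<forall>A\<in>sets M. Q A * (1 - a) \<le> prob A) \<and> ES M a X \<le> fa_expect M Q X"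
proof -
  have [measurable]: "X \<in> borel_measurable M" using X by auto
  have dens: ?thesis if "a < 1" and D: "integrable M D" "\<And>\<omega>. \<omega> \<in> space M \<Longrightarrow> 0 \<le> D \<omega>" "expectation D = 1"
    and bound: "\<And>\<omega>. \<omega> \<in> space M \<Longrightarrow> D \<omega> * (1 - a) \<le> 1"
    and DX: "integrable M (\<lambda>\<omega>. D \<omega> * X \<omega>)" and "ES M a X = ereal (LINT \<omega>|M. D \<omega> * X \<omega>)" for D
  proof -
    note Q = density_in_M1f[OF D]
    show ?thesis
      using Q(1) density_bound_iff[OF Q(2), of "1 - a"] bound fa_expect_density[OF Q(2) _ DX] that(7)
      by (intro bexI[OF _ Q(1)]) auto
  qed
  consider "a = 0" | "0 < a" "a < 1" | "a = 1" using a by linarith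
  then show ?thesis
  proof cases
    case 1
    then show ?thesis
      using X ES_0[OF X] by (intro dens[of "\<lambda>_. 1"]) (auto simp: prob_space)
  next
    case 2
    define q where "q = real_of_ereal (VaR M a X)"
    define U where "U = {\<omega>\<in>space M. q < X \<omega>}"
    define W where "W = {\<omega>\<in>space M. X \<omega> = q}"
    have [measurable]: "U \<in> sets M" "W \<in> sets M" by (auto simp: U_def W_def)
    have "prob (U \<union> W) = prob U + prob W"
      by (intro finite_measure_Union) (auto simp: U_def W_def)
    moreover have "U \<union> W = {\<omega>\<in>space M. q \<le> X \<omega>}" by (auto simp: U_def W_def)
    ultimately have UW: "prob U \<le> 1 - a" "1 - a \<le> prob U + prob W"
      using VaR_tail_bounds[of X a] 2 by (auto simp: q_def U_def)
    \<comment> \<open>The part of the atom \<open>W\<close> that must be added to \<open>U\<close> for total mass \<open>1 - a\<close>; it is \<open>0/0 = 0\<close>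
      when \<open>W\<close> is null, and then \<open>prob U = 1 - a\<close>.\<close>
    define k where "k = (1 - a - prob U) / prob W"
    have k: "0 \<le> k" "k \<le> 1" "prob U + k * prob W = 1 - a"
      using UW by (cases "prob W = 0"; force simp: k_def divide_le_eq_1 zero_less_measure_iff)+
    define D where "D \<omega> = (indicator U \<omega> + k * indicator W \<omega>) / (1 - a)" for \<omega>
    have UW0: "indicator U \<omega> + k * indicator W \<omega> \<le> (1 :: real)"
       "0 \<le> indicator U \<omega> + k * indicator W \<omega>" for \<omega>
      using k by (auto simp: U_def W_def split: split_indicator)
    have D: "integrable M D" "\<And>\<omega>. \<omega> \<in> space M \<Longrightarrow> 0 \<le> D \<omega>" "expectation D = 1"
      using k 2 UW0 by (auto simp: D_def[abs_def] emeasure_eq_measure)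
    have bound: "D \<omega> * (1 - a) \<le> 1" for \<omega>
      using UW0 2 by (simp add: D_def)
    have tail: "integrable M (\<lambda>\<omega>. max (X \<omega> - q) 0)" using X by auto
    \<comment> \<open>D is maximal where X > q and zero where X < q, and on \<open>W\<close> the
      factor X - q vanishes. So D turns the pointwise inequality behind
      \<open>fa_expect_le_ES\<close> into an equality.\<close>
    have DX_eq: "D \<omega> * X \<omega> = q * D \<omega> + max (X \<omega> - q) 0 / (1 - a)" if "\<omega> \<in> space M" for \<omega>
      using that 2 by (auto simp: D_def U_def W_def mult.commute diff_divide_distrib split: split_indicator)
    have DX: "integrable M (\<lambda>\<omega>. D \<omega> * X \<omega>)"
      using D(1) tail by (subst Bochner_Integration.integrable_cong[OF refl DX_eq]) auto
    have "(LINT \<omega>|M. D \<omega> * X \<omega>) = (LINT \<omega>|M. q * D \<omega> + max (X \<omega> - q) 0 / (1 - a))"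
      by (intro Bochner_Integration.integral_cong refl DX_eq)
    also have "\<dots> = q + expectation (\<lambda>\<omega>. max (X \<omega> - q) 0) / (1 - a)"
      using D tail by simp
    finally have "ES M a X = ereal (LINT \<omega>|M. D \<omega> * X \<omega>)"
      using ES_eq_VaR_plus_tail[OF X 2] by (simp add: q_def)
    then show ?thesis
      using 2 D bound DX by (intro dens[of D]) auto
  next
    case 3
    obtain Q where Q: "Q \<in> M1f M" "\<And>s. ereal s < VaR M 1 X \<Longrightarrow> Q {\<omega>\<in>space M. s < X \<omega>} = 1"
      using exists_concentrated_near_ess_sup[of X] by auto
    have "VaR M 1 X \<le> fa_expect M Q X"
    \<comment> \<open>Q has full mass above each real level below the essential supremum, so the
      bound is obtained by approaching it from below.\<close>
    proof (rule dense_le)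
      fix y assume "y < VaR M 1 X"
      then show "y \<le> fa_expect M Q X"
        using fa_expect_ge[OF Q(1) _ Q(2)] by (cases y) auto
    qed
    then show ?thesis
      using 3 Q(1) by (intro bexI[OF _ Q(1)]) (auto simp: ES_def)
  qed
qed

section \<open>Representation and attainment for a decreasing \<Lambda>\<close>

context
  fixes \<Lambda> :: "real \<Rightarrow> real" and X :: "'a \<Rightarrow> real"
  assumes L01: "\<And>x. 0 \<le> \<Lambda> x" "\<And>x. \<Lambda> x \<le> 1" and L_anti: "antimono \<Lambda>"
    and X: "integrable M X"
begin

lemma fa_expect_le_ES_feasible:
  assumes "Q \<in> M1f M" "feasible M \<Lambda> Q x"
  shows "fa_expect M Q X \<le> ES M (\<Lambda> x) X"
  using assms feasible_iff_dominated[where \<Lambda>=\<Lambda>, OF assms(1) L01(2)]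
  by (intro fa_expect_le_ES[OF X _ L01]) auto

lemma ES_attained_feasible:
  "\<exists>Q\<in>M1f M. feasible M \<Lambda> Q x \<and> ES M (\<Lambda> x) X \<le> fa_expect M Q X"
  using ES_attained[OF X L01, of x] feasible_iff_dominated[where \<Lambda>=\<Lambda>, OF _ L01(2)] by blast

lemma R_le_ES_Lambda:
  assumes "Q \<in> M1f M"
  shows "R M \<Lambda> (fa_expect M Q X) Q \<le> ES_Lambda M \<Lambda> X"
  unfolding ES_Lambda_def
  by (intro R_least SUP_upper2 min.mono fa_expect_le_ES_feasible assms) auto

lemma min_ES_le_R: "\<exists>Q\<in>M1f M. min (ES M (\<Lambda> x) X) (ereal x) \<le> R M \<Lambda> (fa_expect M Q X) Q"
proof -
  obtain Q where Q: "Q \<in> M1f M" "feasible M \<Lambda> Q x" "ES M (\<Lambda> x) X \<le> fa_expect M Q X"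
    using ES_attained_feasible by blast
  then have "min (ES M (\<Lambda> x) X) (ereal x) \<le> min (fa_expect M Q X) (ereal x)"
    by (intro min.mono) auto
  also have "\<dots> \<le> R M \<Lambda> (fa_expect M Q X) Q" by (rule R_lower[OF Q(2)])
  finally show ?thesis using Q(1) by blast
qed

lemma ES_Lambda_eq_SUP: "ES_Lambda M \<Lambda> X = (SUP Q\<in>M1f M. R M \<Lambda> (fa_expect M Q X) Q)"
proof (rule antisym)
  show "ES_Lambda M \<Lambda> X \<le> (SUP Q\<in>M1f M. R M \<Lambda> (fa_expect M Q X) Q)"
    unfolding ES_Lambda_def
  proof (rule SUP_least)
    fix x
    obtain Q where "Q \<in> M1f M" "min (ES M (\<Lambda> x) X) (ereal x) \<le> R M \<Lambda> (fa_expect M Q X) Q"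
      using min_ES_le_R by blast
    then show "min (ES M (\<Lambda> x) X) (ereal x) \<le> (SUP Q\<in>M1f M. R M \<Lambda> (fa_expect M Q X) Q)"
      by (meson SUP_upper2)
  qed
  show "(SUP Q\<in>M1f M. R M \<Lambda> (fa_expect M Q X) Q) \<le> ES_Lambda M \<Lambda> X"
    by (intro SUP_least R_le_ES_Lambda)
qed

text \<open>Monotonicity is read off the dual side: a measure attaining the value at y is still
  feasible at the smaller point x.\<close>

lemma ES_compose_antimono:
  assumes "x \<le> y"
  shows "ES M (\<Lambda> y) X \<le> ES M (\<Lambda> x) X"
proof -
  obtain Q where Q: "Q \<in> M1f M" "feasible M \<Lambda> Q y" "ES M (\<Lambda> y) X \<le> fa_expect M Q X"
    using ES_attained_feasible by blast
  have "feasible M \<Lambda> Q x"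
    by (rule feasible_antimono[OF L_anti L01(2) Q(1,2) assms])
  then show ?thesis
    by (intro order_trans[OF Q(3)] fa_expect_le_ES_feasible[OF Q(1)])
qed

text \<open>A term of the supremum exceeding both z and x must come from some y \<ge> x, and moving
  from y down to x can only increase \<open>ES\<close>.\<close>

lemma ES_ge_below_ES_Lambda:
  assumes "ereal x < ES_Lambda M \<Lambda> X"
  shows "ES_Lambda M \<Lambda> X \<le> ES M (\<Lambda> x) X"
proof (rule dense_le)
  fix z assume "z < ES_Lambda M \<Lambda> X"
  then have "max z (ereal x) < ES_Lambda M \<Lambda> X" using assms by simp
  then obtain y where y: "max z (ereal x) < min (ES M (\<Lambda> y) X) (ereal y)"
    by (auto simp: ES_Lambda_def less_SUP_iff)
  then have "z \<le> ES M (\<Lambda> y) X" "x \<le> y" by auto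
  then show "z \<le> ES M (\<Lambda> x) X" using ES_compose_antimono[of x y] by (auto intro: order_trans)
qed

lemma ES_Lambda_attained:
  assumes left_cont: "\<And>x. continuous (at_left x) \<Lambda>"
  shows "\<exists>Q\<in>M1f M. ES_Lambda M \<Lambda> X = R M \<Lambda> (fa_expect M Q X) Q"
proof -
  have "\<exists>Q\<in>M1f M. ES_Lambda M \<Lambda> X \<le> R M \<Lambda> (fa_expect M Q X) Q"
  proof (cases "ES_Lambda M \<Lambda> X")
    case MInf
    then show ?thesis using prob_in_M1f by auto
  next
    case PInf
    then have ES_inf: "ES M (\<Lambda> x) X = \<infinity>" for x using ES_ge_below_ES_Lambda[of x] by simp
    \<comment> \<open>Below level 1 \<open>ES\<close> is real by definition, so an infinite value
      forces level 1.\<close>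
    have L1: "\<Lambda> x = 1" for x
      using ES_inf[of x] L01(2)[of x] by (auto simp: ES_def split: if_splits)
    \<comment> \<open>With \<Lambda> constantly 1 every x is feasible, so one Q with infinite
      expectation serves all x at once.\<close>
    obtain Q where Q: "Q \<in> M1f M" "ES M (\<Lambda> 0) X \<le> fa_expect M Q X"
      using ES_attained_feasible by blast
    have "ereal x \<le> R M \<Lambda> (fa_expect M Q X) Q" for x
      using R_lower[of M \<Lambda> Q x "fa_expect M Q X"] Q(2) ES_inf[of 0] by (simp add: feasible_def L1)
    then have "R M \<Lambda> (fa_expect M Q X) Q = \<infinity>" by (rule ereal_top)
    then show ?thesis using Q(1) by (intro bexI[OF _ Q(1)]) simp
  next
    case (real v)
    have below: "ereal v \<le> ES M (\<Lambda> x) X" if "x < v" for x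
      using ES_ge_below_ES_Lambda[of x] that real by simp
    have "ereal v \<le> ES M (\<Lambda> v) X"
    proof (cases "\<Lambda> v = 1")
      case True
      \<comment> \<open>The level is already 1 at v - 1, so the bound known strictly below v
        transfers without a limit.\<close>
      have "\<Lambda> v \<le> \<Lambda> (v - 1)" using L_anti by (rule antimonoD) simp
      then have "\<Lambda> (v - 1) = \<Lambda> v" using True L01(2)[of "v - 1"] by simp
      then show ?thesis using below[of "v - 1"] by simp
    next
      case False
      then have lt: "\<Lambda> v < 1" using L01(2)[of v] by simp
      \<comment> \<open>The limit is taken in the inequality multiplied by 1 - \<Lambda> x, so only
        the unnormalized tail integral has to be continuous in the level.\<close>
      let ?J = "\<lambda>a. LINT \<beta>:{a..1}|lborel. real_of_ereal (VaR M \<beta> X)"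
      have lim: "(\<Lambda> \<longlongrightarrow> \<Lambda> v) (at_left v)"
        using left_cont[of v] by (simp add: continuous_within)
      have "((\<lambda>x. ?J (\<Lambda> x)) \<longlongrightarrow> ?J (\<Lambda> v)) (at_left v)"
        by (rule continuous_on_tendsto_compose[OF VaR_integral_continuous lim])
          (use X L01 in \<open>auto intro!: always_eventually\<close>)
      moreover have "((\<lambda>x. (1 - \<Lambda> x) * v) \<longlongrightarrow> (1 - \<Lambda> v) * v) (at_left v)"
        by (intro tendsto_intros lim)
      \<comment> \<open>Close to v from the left \<Lambda> x is still below 1, so \<open>ES\<close>
        is given by its integral formula there.\<close>
      moreover have "\<forall>\<^sub>F x in at_left v. (1 - \<Lambda> x) * v \<le> ?J (\<Lambda> x)"
        using order_tendstoD(2)[OF lim lt] eventually_at_left_real[of "v - 1" v, simplified]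
      proof eventually_elim
        case (elim x)
        then show ?case using below[of x] by (simp add: ES_def field_simps)
      qed
      ultimately have "(1 - \<Lambda> v) * v \<le> ?J (\<Lambda> v)"
        by (intro tendsto_le[of "at_left v"]) auto
      then show ?thesis using lt by (simp add: ES_def field_simps)
    qed
    then show ?thesis using min_ES_le_R[of v] real by (simp add: min_def split: if_splits)
  qed
  then show ?thesis using R_le_ES_Lambda by (auto intro: antisym)
qed

end
end

theorem theorem7:
  fixes M :: "'a measure" and \<Lambda> :: "real \<Rightarrow> real"
  assumes P: "prob_space M" and atl: "atomless M"
    and Lrange: "\<And>x. 0 \<le> \<Lambda> x \<and> \<Lambda> x \<le> 1"
    and Ldec: "antimono \<Lambda>"
  shows "(\<forall>X. integrable M X \<longrightarrow>
           ES_Lambda M \<Lambda> X = (SUP Q\<in>M1f M. R M \<Lambda> (fa_expect M Q X) Q))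
    \<and> ((\<forall>x. continuous (at_left x) \<Lambda>) \<longrightarrow>
         (\<forall>X. integrable M X \<longrightarrow>
            (\<exists>Q\<in>M1f M. ES_Lambda M \<Lambda> X = R M \<Lambda> (fa_expect M Q X) Q)))
    \<and> usc_on (UNIV \<times> M1f M) (\<lambda>(t, Q). R M \<Lambda> (ereal t) Q)
    \<and> (\<forall>t1 t2 Q1 Q2 l. Q1 \<in> M1f M \<longrightarrow> Q2 \<in> M1f M \<longrightarrow> 0 \<le> l \<longrightarrow> l \<le> 1 \<longrightarrow>
         min (R M \<Lambda> (ereal t1) Q1) (R M \<Lambda> (ereal t2) Q2)
           \<le> R M \<Lambda> (ereal (l * t1 + (1 - l) * t2)) (\<lambda>A. l * Q1 A + (1 - l) * Q2 A))
    \<and> (\<forall>Q\<in>M1f M. mono (\<lambda>t::real. R M \<Lambda> (ereal t) Q))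
    \<and> (\<forall>Q\<in>M1f M. \<forall>Q'\<in>M1f M. (INF t::real. R M \<Lambda> (ereal t) Q) = (INF t::real. R M \<Lambda> (ereal t) Q'))
    \<and> (\<forall>Q\<in>M1f M. \<forall>t1 t2::real. t2 \<le> t1 \<longrightarrow>
         R M \<Lambda> (ereal t1) Q \<le> R M \<Lambda> (ereal t2) Q + ereal (t1 - t2))"
proof -
  interpret prob_space M by (rule P)
  have L0: "\<And>x. 0 \<le> \<Lambda> x" and L1: "\<And>x. \<Lambda> x \<le> 1" using Lrange by auto
  show ?thesis
    by (intro conjI allI impI ballI monoI INF_R[THEN trans, OF INF_R[symmetric]]
        ES_Lambda_eq_SUP[OF L0 L1 Ldec] ES_Lambda_attained[OF L0 L1 Ldec]
        R_usc[OF Ldec L1] R_quasi_concave[OF Ldec L1] R_mono R_nonexpansive) auto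
qed

end
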